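(* Let $Q\in\mathbb{H}[s,t]$ be primitive. Write $Q=Q_0+Q_1\cdot s+\cdots+Q_d\cdot s^d$ with $d\in\mathbb{Z}_{>0}$ and $Q_i\in\mathbb{H}[t]$ for all $i\in I:=\{0,\ldots,d\}$. Let $P\in\mathbb{R}[t]$ be a monic quadratic polynomial. (a) $P\mid Q_i\cdot Q_j^*$ for all $i,j\in I$ if and only if $Q=\tilde{Q}\cdot(t-h)$ for some $\tilde{Q}\in\mathbb{H}[s,t]$ and $h\in\mathbb{H}$ such that $P=(t-h)\cdot(t-h)^*$. (b) $P\mid Q_i^*\cdot Q_j$ for all $i,j\in I$ if and only if $Q=(t-h)\cdot\tilde{Q}$ for some $\tilde{Q}\in\mathbb{H}[s,t]$ and $h\in\mathbb{H}$ such that $P=(t-h)\cdot(t-h)^*$.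
   Context: $\mathbb{H}=\langle 1,\mathbf{i},\mathbf{j},\mathbf{k}\rangle_{\mathbb{R}}$ denotes the quaternions and $\mathbb{H}_{\mathbb{C}}=\mathbb{H}\otimes_{\mathbb{R}}\mathbb{C}$ the complex quaternions (the imaginary unit of $\mathbb{C}$ is central and different from $\mathbf{i}$). The conjugate of $h=h_1+h_2\mathbf{i}+h_3\mathbf{j}+h_4\mathbf{k}$ is $h^*=h_1-h_2\mathbf{i}-h_3\mathbf{j}-h_4\mathbf{k}$. $\mathbb{H}_{\mathbb{C}}[s,t]$ is the ring of polynomials with coefficients in $\mathbb{H}_{\mathbb{C}}$, where the variables $s,t$ commute with each other and with the coefficients; $\mathbb{H}[s,t]\subset\mathbb{H}_{\mathbb{C}}[s,t]$. The conjugate $Q^*$ of a polynomial is obtained by conjugating its coefficients. For $P\in\mathbb{C}[s,t]$ and $Q\in\mathbb{H}_{\mathbb{C}}[s,t]$, write $P\mid Q$ if $Q=P\cdot\tilde{Q}$ for some $\tilde{Q}\in\mathbb{H}_{\mathbb{C}}[s,t]$. $Q$ is called primitive if $P\nmid Q$ for all non-constant $P\in\mathbb{C}[s,t]$. *)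

theory Defs
  imports Complex_Main "HOL-Library.Poly_Mapping" "HOL-Library.Product_Plus"
    "HOL-Computational_Algebra.Polynomial"
begin

text \<open>
  Quaternions with coefficients in a commutative ring \<open>'a\<close>: \<open>real quaternion\<close> is the usual skew
  field, and \<open>complex quaternion\<close> is its complexification, the imaginary unit of \<open>complex\<close> being
  a central scalar distinct from \<open>quat_i\<close>.
\<close>

codatatype 'a quaternion = Quaternion (Q1: 'a) (Qi: 'a) (Qj: 'a) (Qk: 'a)

lemma quaternion_eqI [intro?]:
  "Q1 x = Q1 y \<Longrightarrow> Qi x = Qi y \<Longrightarrow> Qj x = Qj y \<Longrightarrow> Qk x = Qk y \<Longrightarrow> x = y"
  by (rule quaternion.expand) simp

lemma quaternion_eq_iff:
  "x = y \<longleftrightarrow> Q1 x = Q1 y \<and> Qi x = Qi y \<and> Qj x = Qj y \<and> Qk x = Qk y"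
  by (auto intro: quaternion_eqI)

instantiation quaternion :: (zero) zero
begin
primcorec zero_quaternion where
  "Q1 0 = 0" | "Qi 0 = 0" | "Qj 0 = 0" | "Qk 0 = 0"
instance ..
end

instantiation quaternion :: (zero_neq_one) zero_neq_one
begin
primcorec one_quaternion where
  "Q1 1 = 1" | "Qi 1 = 0" | "Qj 1 = 0" | "Qk 1 = 0"
instance by standard (simp add: quaternion_eq_iff)
end

instantiation quaternion :: (ab_group_add) ab_group_add
begin
primcorec plus_quaternion where
  "Q1 (x + y) = Q1 x + Q1 y"
| "Qi (x + y) = Qi x + Qi y"
| "Qj (x + y) = Qj x + Qj y"
| "Qk (x + y) = Qk x + Qk y"
primcorec uminus_quaternion where
  "Q1 (- x) = - Q1 x" | "Qi (- x) = - Qi x" | "Qj (- x) = - Qj x" | "Qk (- x) = - Qk x"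
primcorec minus_quaternion where
  "Q1 (x - y) = Q1 x - Q1 y"
| "Qi (x - y) = Qi x - Qi y"
| "Qj (x - y) = Qj x - Qj y"
| "Qk (x - y) = Qk x - Qk y"
instance by standard (simp_all add: quaternion_eq_iff algebra_simps)
end

instantiation quaternion :: (comm_ring_1) ring_1
begin
primcorec times_quaternion where
  "Q1 (x * y) = Q1 x * Q1 y - Qi x * Qi y - Qj x * Qj y - Qk x * Qk y"
| "Qi (x * y) = Q1 x * Qi y + Qi x * Q1 y + Qj x * Qk y - Qk x * Qj y"
| "Qj (x * y) = Q1 x * Qj y - Qi x * Qk y + Qj x * Q1 y + Qk x * Qi y"
| "Qk (x * y) = Q1 x * Qk y + Qi x * Qj y - Qj x * Qi y + Qk x * Q1 y"
instance by standard (simp_all add: quaternion_eq_iff algebra_simps)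
end

definition quat_i :: "'a::comm_ring_1 quaternion" where "quat_i = Quaternion 0 1 0 0"
definition quat_j :: "'a::comm_ring_1 quaternion" where "quat_j = Quaternion 0 0 1 0"
definition quat_k :: "'a::comm_ring_1 quaternion" where "quat_k = Quaternion 0 0 0 1"

lemma quat_units:
  "quat_i * quat_i = - 1" "quat_j * quat_j = - 1" "quat_k * quat_k = - 1"
  "quat_i * quat_j = quat_k" "quat_j * quat_k = quat_i" "quat_k * quat_i = quat_j"
  "quat_j * quat_i = - quat_k" "quat_k * quat_j = - quat_i" "quat_i * quat_k = - quat_j"
  by (simp_all add: quaternion_eq_iff quat_i_def quat_j_def quat_k_def)

definition quat_scalar :: "'a::zero \<Rightarrow> 'a quaternion" where
  "quat_scalar a = Quaternion a 0 0 0"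

text \<open>On \<open>complex quaternion\<close> this is complex linear: the scalars are not conjugated.\<close>

primcorec quat_cnj :: "'a::uminus quaternion \<Rightarrow> 'a quaternion" where
  "Q1 (quat_cnj h) = Q1 h"
| "Qi (quat_cnj h) = - Qi h"
| "Qj (quat_cnj h) = - Qj h"
| "Qk (quat_cnj h) = - Qk h"

lemma quat_cnj_mult: "quat_cnj (x * y) = quat_cnj y * quat_cnj x"
  for x y :: "'a::comm_ring_1 quaternion"
  by (simp add: quaternion_eq_iff algebra_simps)

text \<open>
  Polynomials in two central commuting variables \<open>s\<close> and \<open>t\<close>: the exponent \<open>(m, n)\<close> stands for
  the monomial \<open>s ^ m * t ^ n\<close>, and multiplication is the convolution product of
  \<^theory>\<open>HOL-Library.Poly_Mapping\<close>, which does not need commuting coefficients.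
\<close>

type_synonym 'a poly_st = "(nat \<times> nat) \<Rightarrow>\<^sub>0 'a"

definition const_st :: "'a::zero \<Rightarrow> 'a poly_st" where
  "const_st c = Poly_Mapping.single (0, 0) c"

definition var_s :: "'a::zero_neq_one poly_st" where
  "var_s = Poly_Mapping.single (1, 0) 1"

definition var_t :: "'a::zero_neq_one poly_st" where
  "var_t = Poly_Mapping.single (0, 1) 1"

text \<open>
  The type \<open>'a poly\<close> serves as the additive group of polynomials in \<open>t\<close> alone. For quaternion
  coefficients it carries no multiplication, so products are formed after this embedding.
\<close>

definition in_t :: "'a::comm_monoid_add poly \<Rightarrow> 'a poly_st" where
  "in_t p = (\<Sum>n\<le>degree p. Poly_Mapping.single (0, n) (coeff p n))"

definition cnj_st :: "'a::ab_group_add quaternion poly_st \<Rightarrow> 'a quaternion poly_st" where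
  "cnj_st = Poly_Mapping.map quat_cnj"

definition scalar_st :: "'a::zero poly_st \<Rightarrow> 'a quaternion poly_st" where
  "scalar_st = Poly_Mapping.map quat_scalar"

definition complexify_st :: "real poly_st \<Rightarrow> complex poly_st" where
  "complexify_st = Poly_Mapping.map complex_of_real"

definition complexify_quat_st :: "real quaternion poly_st \<Rightarrow> complex quaternion poly_st" where
  "complexify_quat_st = Poly_Mapping.map (map_quaternion complex_of_real)"

lemma lookup_in_t: "Poly_Mapping.lookup (in_t p) (m, n) = (if m = 0 then coeff p n else 0)"
proof -
  have "Poly_Mapping.lookup (in_t p) (m, n) =
      (\<Sum>k\<le>degree p. if k = n then (if m = 0 then coeff p n else 0) else 0)"
    unfolding in_t_def lookup_sum
    by (rule sum.cong) (auto simp: lookup_single when_def)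
  then show ?thesis
    by (simp add: coeff_eq_0)
qed

lemma lookup_cnj_st: "Poly_Mapping.lookup (cnj_st p) m = quat_cnj (Poly_Mapping.lookup p m)"
  by (simp add: cnj_st_def Poly_Mapping.map.rep_eq when_def quaternion_eq_iff quat_scalar_def quaternion.map_sel)

lemma lookup_scalar_st: "Poly_Mapping.lookup (scalar_st p) m = quat_scalar (Poly_Mapping.lookup p m)"
  by (simp add: scalar_st_def Poly_Mapping.map.rep_eq when_def quaternion_eq_iff quat_scalar_def quaternion.map_sel)

lemma lookup_complexify_st: "Poly_Mapping.lookup (complexify_st p) m = complex_of_real (Poly_Mapping.lookup p m)"
  by (simp add: complexify_st_def Poly_Mapping.map.rep_eq when_def quaternion_eq_iff quat_scalar_def quaternion.map_sel)

lemma lookup_complexify_quat_st: "Poly_Mapping.lookup (complexify_quat_st p) m = map_quaternion complex_of_real (Poly_Mapping.lookup p m)"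
  by (simp add: complexify_quat_st_def Poly_Mapping.map.rep_eq when_def quaternion_eq_iff quat_scalar_def quaternion.map_sel)

definition divides_st :: "complex poly_st \<Rightarrow> complex quaternion poly_st \<Rightarrow> bool" where
  "divides_st P Q \<longleftrightarrow> (\<exists>Q'. Q = scalar_st P * Q')"

definition primitive_st :: "complex quaternion poly_st \<Rightarrow> bool" where
  "primitive_st Q \<longleftrightarrow> (\<forall>P. (\<nexists>c. P = const_st c) \<longrightarrow> \<not> divides_st P Q)"

end

theory Submission
  imports Defs
begin

text \<open>
  Divide \<open>Q\<^sub>i = P S\<^sub>i + R\<^sub>i\<close> with \<open>R\<^sub>i = A\<^sub>i t + B\<^sub>i\<close>. If \<open>P\<close> divides all \<open>Q\<^sub>i Q\<^sub>j\<^sup>*\<close>, then by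
  comparing degrees \<open>R\<^sub>i R\<^sub>j\<^sup>* = A\<^sub>i A\<^sub>j\<^sup>* P\<close>. Not all \<open>A\<^sub>i\<close> vanish, since otherwise all \<open>B\<^sub>i\<close> vanish and
  \<open>P\<close> divides \<open>Q\<close>. If \<open>A\<^sub>k \<noteq> 0\<close>, then \<open>h = - A\<^sub>k\<^sup>-\<^sup>1 B\<^sub>k\<close> satisfies \<open>P = (t - h)(t - h)\<^sup>*\<close>, and cancelling
  \<open>A\<^sub>k\<^sup>*\<close> in the identity for \<open>R\<^sub>i R\<^sub>k\<^sup>*\<close> gives \<open>R\<^sub>i = A\<^sub>i (t - h)\<close> for every \<open>i\<close>. The converse compares
  the coefficients of powers of \<open>s\<close>, and part (b) is part (a) for \<open>Q\<^sup>*\<close>.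
\<close>

section \<open>Coefficients of products of polynomials in \<open>s\<close> and
  \<open>t\<close>\<close>

lemma lookup_mult_st:
  fixes X Y :: "'a::semiring_0 poly_st"
  shows "Poly_Mapping.lookup (X * Y) (m, n) =
    (\<Sum>i\<le>m. \<Sum>j\<le>n. Poly_Mapping.lookup X (i, j) * Poly_Mapping.lookup Y (m - i, n - j))"
proof -
  \<comment> \<open>At most one right exponent completes \<open>(i, j)\<close> to
    \<open>(m, n)\<close>, and none does if \<open>(i, j)\<close> is too large in some coordinate.
    This collapses the inner sum of the convolution and bounds the outer one.\<close>
  have inner: "Sum_any (\<lambda>q. Poly_Mapping.lookup Y q when (m, n) = (i, j) + q) =
      (Poly_Mapping.lookup Y (m - i, n - j) when i \<le> m \<and> j \<le> n)" for i j
  proof (cases "i \<le> m \<and> j \<le> n")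
    case True
    then have "((m, n) = (i, j) + q) = (q = (m - i, n - j))" for q
      by (cases q) auto
    with True show ?thesis by simp
  next
    case False
    then have "(m, n) \<noteq> (i, j) + q" for q
      by (cases q) auto
    then show ?thesis using False by (auto simp: when_def)
  qed
  have "Poly_Mapping.lookup (X * Y) (m, n) = Sum_any (\<lambda>(i, j). Poly_Mapping.lookup X (i, j) *
      (Poly_Mapping.lookup Y (m - i, n - j) when i \<le> m \<and> j \<le> n))"
    by (simp add: lookup_mult inner case_prod_unfold flip: inner)
  also have "\<dots> = (\<Sum>(i, j)\<in>{..m} \<times> {..n}. Poly_Mapping.lookup X (i, j) *
      (Poly_Mapping.lookup Y (m - i, n - j) when i \<le> m \<and> j \<le> n))"
    by (rule Sum_any.expand_superset) (auto simp: when_def split: if_splits)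
  also have "\<dots> = (\<Sum>i\<le>m. \<Sum>j\<le>n. Poly_Mapping.lookup X (i, j) * Poly_Mapping.lookup Y (m - i, n - j))"
    by (simp add: sum.cartesian_product[symmetric])
  finally show ?thesis .
qed

lemma lookup_const_st: "Poly_Mapping.lookup (const_st a) (m, n) = (if m = 0 \<and> n = 0 then a else 0)"
  by (auto simp: const_st_def lookup_single when_def)

lemma lookup_var_t: "Poly_Mapping.lookup var_t (m, n) = (if m = 0 \<and> n = 1 then 1 else 0)"
  by (auto simp: var_t_def lookup_single when_def)

lemma lookup_const_st_mult:
  "Poly_Mapping.lookup (const_st a * X) (m, n) = a * Poly_Mapping.lookup X (m, n)"
  for X :: "'a::semiring_0 poly_st"
proof -
  have "Poly_Mapping.lookup (const_st a * X) (m, n) = (\<Sum>i\<le>m. \<Sum>j\<le>n.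
      if i = 0 then if j = 0 then a * Poly_Mapping.lookup X (m, n) else 0 else 0)"
    unfolding lookup_mult_st const_st_def
    by (intro sum.cong) (auto simp: lookup_single when_def)
  then show ?thesis
    by (simp add: sum.swap [of _ "{..n}"])
qed

lemma lookup_mult_const_st:
  "Poly_Mapping.lookup (X * const_st a) (m, n) = Poly_Mapping.lookup X (m, n) * a"
  for X :: "'a::semiring_0 poly_st"
proof -
  have "Poly_Mapping.lookup (X * const_st a) (m, n) = (\<Sum>i\<le>m. \<Sum>j\<le>n.
      if i = m then if j = n then Poly_Mapping.lookup X (m, n) * a else 0 else 0)"
    unfolding lookup_mult_st const_st_def
    by (intro sum.cong) (auto simp: lookup_single when_def)
  then show ?thesis
    by (simp add: sum.swap [of _ "{..n}"])
qed

lemma lookup_var_t_mult: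
  "Poly_Mapping.lookup (var_t * X) (m, n) = (if n = 0 then 0 else Poly_Mapping.lookup X (m, n - 1))"
  for X :: "'a::semiring_1 poly_st"
proof -
  have "Poly_Mapping.lookup (var_t * X) (m, n) = (\<Sum>i\<le>m. \<Sum>j\<le>n.
      if i = 0 then if j = 1 then Poly_Mapping.lookup X (m, n - 1) else 0 else 0)"
    unfolding lookup_mult_st var_t_def
    by (intro sum.cong) (auto simp: lookup_single when_def)
  then show ?thesis
    by (simp add: sum.swap [of _ "{..n}"])
qed

lemma lookup_mult_var_t:
  "Poly_Mapping.lookup (X * var_t) (m, n) = (if n = 0 then 0 else Poly_Mapping.lookup X (m, n - 1))"
  for X :: "'a::semiring_1 poly_st"
proof -
  \<comment> \<open>For \<open>n = 0\<close> the truncated \<open>n - 1\<close> is \<open>0\<close>,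
    so without the guard \<open>n \<noteq> 0\<close> the index \<open>j = 0\<close> would be
    hit.\<close>
  have "Poly_Mapping.lookup (X * var_t) (m, n) = (\<Sum>i\<le>m. \<Sum>j\<le>n.
      if i = m then if j = n - 1 \<and> n \<noteq> 0 then Poly_Mapping.lookup X (m, n - 1) else 0 else 0)"
    unfolding lookup_mult_st var_t_def
    by (intro sum.cong) (auto simp: lookup_single when_def)
  then show ?thesis
    by (simp add: sum.swap [of _ "{..n}"])
qed

lemma lookup_var_s_mult:
  "Poly_Mapping.lookup (var_s * X) (m, n) = (if m = 0 then 0 else Poly_Mapping.lookup X (m - 1, n))"
  for X :: "'a::semiring_1 poly_st"
proof -
  have "Poly_Mapping.lookup (var_s * X) (m, n) = (\<Sum>i\<le>m. \<Sum>j\<le>n.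
      if i = 1 then if j = 0 then Poly_Mapping.lookup X (m - 1, n) else 0 else 0)"
    unfolding lookup_mult_st var_s_def
    by (intro sum.cong) (auto simp: lookup_single when_def)
  then show ?thesis
    by (simp add: sum.swap [of _ "{..n}"])
qed

lemma lookup_mult_var_s:
  "Poly_Mapping.lookup (X * var_s) (m, n) = (if m = 0 then 0 else Poly_Mapping.lookup X (m - 1, n))"
  for X :: "'a::semiring_1 poly_st"
proof -
  have "Poly_Mapping.lookup (X * var_s) (m, n) = (\<Sum>i\<le>m. \<Sum>j\<le>n.
      if i = m - 1 \<and> m \<noteq> 0 then if j = n then Poly_Mapping.lookup X (m - 1, n) else 0 else 0)"
    unfolding lookup_mult_st var_s_def
    by (intro sum.cong) (auto simp: lookup_single when_def)
  then show ?thesis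
    by (simp add: sum.swap [of _ "{..n}"])
qed

lemma poly_st_eqI:
  assumes "\<And>m n. Poly_Mapping.lookup X (m, n) = Poly_Mapping.lookup Y (m, n)"
  shows "X = Y"
  using assms by (intro poly_mapping_eqI) auto

text \<open>With noncommutative coefficients \<open>'a poly_st\<close> is not a commutative ring, so
  centrality of the variables is a separate fact: multiplication by \<open>t\<close> on either side
  shifts the exponent of \<open>t\<close> by one.\<close>

lemma var_t_commute: "var_t * X = X * var_t"
  for X :: "'a::semiring_1 poly_st"
  by (rule poly_st_eqI) (simp add: lookup_var_t_mult lookup_mult_var_t)

lemma var_s_commute: "var_s * X = X * var_s"
  for X :: "'a::semiring_1 poly_st"
  by (rule poly_st_eqI) (simp add: lookup_var_s_mult lookup_mult_var_s)

lemma var_s_power_commute: "var_s ^ i * X = X * var_s ^ i"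
  for X :: "'a::semiring_1 poly_st"
  by (induction i) (simp_all add: mult.assoc power_commutes, metis mult.assoc var_s_commute)

lemma lookup_mult_var_s_power:
  "Poly_Mapping.lookup (X * var_s ^ i) (m, n) =
    (if m < i then 0 else Poly_Mapping.lookup X (m - i, n))"
  for X :: "'a::semiring_1 poly_st"
proof (induction i arbitrary: m)
  case (Suc i)
  have "X * var_s ^ Suc i = (X * var_s ^ i) * var_s"
    by (simp only: power_Suc2 mult.assoc)
  then show ?case
    using Suc by (auto simp: lookup_mult_var_s simp del: power_Suc)
qed simp

section \<open>Embedded constants and central scalars\<close>

lemma const_st_arith:
  "const_st (a + b) = const_st a + const_st b" "const_st (a - b) = const_st a - const_st b"
  "const_st (- a) = - const_st a"
  for a b :: "'a::ab_group_add"
  by (simp_all add: const_st_def single_add single_diff single_uminus)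

lemma const_st_mult: "const_st (a * b) = const_st a * const_st b"
  for a b :: "'a::semiring_0"
  by (simp add: const_st_def mult_single)

lemma const_st_zero [simp]: "const_st 0 = 0"
  by (simp add: const_st_def)

lemma quat_scalar_sel [simp]:
  "Q1 (quat_scalar a) = a" "Qi (quat_scalar a) = 0" "Qj (quat_scalar a) = 0" "Qk (quat_scalar a) = 0"
  by (simp_all add: quat_scalar_def)

lemma quat_scalar_commute: "quat_scalar a * x = x * quat_scalar a"
  for x :: "'a::comm_ring_1 quaternion"
  by (simp add: quaternion_eq_iff algebra_simps)

text \<open>Reversing both indices exchanges the two factors of a convolution, as needed for
  commuting with scalars and for conjugating products.\<close>

lemma sum_sum_reflect:
  "(\<Sum>i\<le>m. \<Sum>j\<le>n. f i j) = (\<Sum>i\<le>m. \<Sum>j\<le>n. f (m - i) (n - j))"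
  for m n :: nat
proof -
  have reflect: "(\<Sum>i\<le>k. g i) = (\<Sum>i\<le>k. g (k - i))" for k :: nat and g :: "nat \<Rightarrow> 'a"
    by (rule sum.reindex_bij_witness [of _ "\<lambda>i. k - i" "\<lambda>i. k - i"]) auto
  show ?thesis
    by (subst reflect) (intro sum.cong refl reflect)
qed

lemma scalar_st_commute: "scalar_st p * X = X * scalar_st p"
  for X :: "'a::comm_ring_1 quaternion poly_st"
proof (rule poly_st_eqI)
  fix m n
  have "Poly_Mapping.lookup (scalar_st p * X) (m, n) = (\<Sum>i\<le>m. \<Sum>j\<le>n.
      Poly_Mapping.lookup X (m - i, n - j) * quat_scalar (Poly_Mapping.lookup p (i, j)))"
    by (simp add: lookup_mult_st lookup_scalar_st quat_scalar_commute)
  also have "\<dots> = (\<Sum>i\<le>m. \<Sum>j\<le>n.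
      Poly_Mapping.lookup X (i, j) * quat_scalar (Poly_Mapping.lookup p (m - i, n - j)))"
    by (subst sum_sum_reflect) (intro sum.cong, simp_all)
  finally show "Poly_Mapping.lookup (scalar_st p * X) (m, n) =
      Poly_Mapping.lookup (X * scalar_st p) (m, n)"
    by (simp add: lookup_mult_st lookup_scalar_st)
qed

section \<open>Conjugation of quaternions and of polynomials\<close>

lemma quat_cnj_arith [simp]:
  "quat_cnj (x + y) = quat_cnj x + quat_cnj y" "quat_cnj (x - y) = quat_cnj x - quat_cnj y"
  "quat_cnj (- x) = - quat_cnj x" "quat_cnj 0 = (0 :: 'a quaternion)"
  "quat_cnj 1 = (1 :: 'b::comm_ring_1 quaternion)" "quat_cnj (quat_cnj x) = x"
  for x y :: "'a::ab_group_add quaternion"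
  by (simp_all add: quaternion_eq_iff)

lemma quat_cnj_scalar [simp]: "quat_cnj (quat_scalar a) = quat_scalar a"
  for a :: "'a::ab_group_add"
  by (simp add: quaternion_eq_iff)

lemma quat_cnj_sum: "quat_cnj (sum f A) = (\<Sum>x\<in>A. quat_cnj (f x))"
  for f :: "'b \<Rightarrow> 'a::ab_group_add quaternion"
  by (induction A rule: infinite_finite_induct) simp_all

text \<open>The variables are central, so the reversal of products by \<open>quat_cnj\<close> passes
  from coefficients to polynomials. This later exchanges left and right factors.\<close>

lemma cnj_st_mult: "cnj_st (X * Y) = cnj_st Y * cnj_st X"
  for X Y :: "'a::comm_ring_1 quaternion poly_st"
proof (rule poly_st_eqI)
  fix m n
  have "Poly_Mapping.lookup (cnj_st (X * Y)) (m, n) = (\<Sum>i\<le>m. \<Sum>j\<le>n.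
      quat_cnj (Poly_Mapping.lookup Y (m - i, n - j)) * quat_cnj (Poly_Mapping.lookup X (i, j)))"
    by (simp add: lookup_mult_st lookup_cnj_st quat_cnj_sum quat_cnj_mult)
  also have "\<dots> = (\<Sum>i\<le>m. \<Sum>j\<le>n.
      quat_cnj (Poly_Mapping.lookup Y (i, j)) * quat_cnj (Poly_Mapping.lookup X (m - i, n - j)))"
    by (subst sum_sum_reflect) (intro sum.cong, simp_all)
  finally show "Poly_Mapping.lookup (cnj_st (X * Y)) (m, n) =
      Poly_Mapping.lookup (cnj_st Y * cnj_st X) (m, n)"
    by (simp add: lookup_mult_st lookup_cnj_st)
qed

lemma cnj_st_arith [simp]:
  "cnj_st (X + Y) = cnj_st X + cnj_st Y" "cnj_st (X - Y) = cnj_st X - cnj_st Y"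
  "cnj_st (- X) = - cnj_st X" "cnj_st 0 = (0 :: 'a quaternion poly_st)" "cnj_st (cnj_st X) = X"
  for X Y :: "'a::ab_group_add quaternion poly_st"
  by (rule poly_st_eqI; simp add: lookup_cnj_st lookup_add lookup_minus)+

lemma cnj_st_const_st [simp]: "cnj_st (const_st a) = const_st (quat_cnj a)"
  for a :: "'a::ab_group_add quaternion"
  by (rule poly_st_eqI) (simp add: lookup_cnj_st const_st_def lookup_single when_def)

lemma cnj_st_var_t [simp]: "cnj_st var_t = (var_t :: 'a::comm_ring_1 quaternion poly_st)"
  by (rule poly_st_eqI) (simp add: lookup_cnj_st var_t_def lookup_single when_def)

lemma cnj_st_var_s_power [simp]: "cnj_st (var_s ^ i) = (var_s ^ i :: 'a::comm_ring_1 quaternion poly_st)"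
proof (induction i)
  case 0
  show ?case
    by (rule poly_st_eqI) (simp add: lookup_cnj_st lookup_one when_def)
next
  case (Suc i)
  have "cnj_st var_s = (var_s :: 'a quaternion poly_st)"
    by (rule poly_st_eqI) (simp add: lookup_cnj_st var_s_def lookup_single when_def)
  then show ?case
    using Suc by (simp add: cnj_st_mult power_commutes)
qed

lemma cnj_st_scalar_st [simp]: "cnj_st (scalar_st p) = scalar_st p"
  for p :: "'a::ab_group_add poly_st"
  by (rule poly_st_eqI) (simp add: lookup_cnj_st lookup_scalar_st)

lemma cnj_st_sum: "cnj_st (sum f A) = (\<Sum>x\<in>A. cnj_st (f x))"
  for f :: "'b \<Rightarrow> 'a::ab_group_add quaternion poly_st"
  by (induction A rule: infinite_finite_induct) simp_all

lemma cnj_st_in_t: "cnj_st (in_t p) = in_t (map_poly quat_cnj p)"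
  for p :: "'a::ab_group_add quaternion poly"
  by (rule poly_st_eqI) (simp add: lookup_cnj_st lookup_in_t coeff_map_poly)

section \<open>Passage between real and complex coefficients\<close>

lemma map_quaternion_sel [simp]:
  "Q1 (map_quaternion f x) = f (Q1 x)" "Qi (map_quaternion f x) = f (Qi x)"
  "Qj (map_quaternion f x) = f (Qj x)" "Qk (map_quaternion f x) = f (Qk x)"
  by (simp_all add: quaternion.map_sel)

lemma map_quaternion_of_real_mult:
  "map_quaternion complex_of_real (x * y) =
    map_quaternion complex_of_real x * map_quaternion complex_of_real y"
  by (simp add: quaternion_eq_iff)

text \<open>Additivity alone is required of \<open>g\<close>, so that both
  \<open>complex_of_real\<close> and the non-multiplicative \<open>Re\<close> are covered.\<close>

lemma map_quaternion_sum:
  fixes f :: "'c \<Rightarrow> 'a::ab_group_add quaternion" and g :: "'a \<Rightarrow> 'b::ab_group_add"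
  assumes "g 0 = 0" and "\<And>x y. g (x + y) = g x + g y"
  shows "map_quaternion g (sum f A) = (\<Sum>x\<in>A. map_quaternion g (f x))"
  by (induction A rule: infinite_finite_induct) (simp_all add: quaternion_eq_iff assms)

lemma complexify_quat_st_mult:
  "complexify_quat_st (X * Y) = complexify_quat_st X * complexify_quat_st Y"
  by (rule poly_st_eqI)
    (simp add: lookup_complexify_quat_st lookup_mult_st map_quaternion_sum map_quaternion_of_real_mult)

lemma complexify_quat_scalar_st:
  "complexify_quat_st (scalar_st p) = scalar_st (complexify_st p)"
  by (rule poly_st_eqI)
    (simp add: lookup_complexify_quat_st lookup_scalar_st lookup_complexify_st quaternion_eq_iff)

text \<open>The nontrivial direction takes real parts of the coefficients of the complex quotient.\<close>

lemma divides_st_complexify_iff: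
  "divides_st (complexify_st p) (complexify_quat_st X) \<longleftrightarrow> (\<exists>Y. X = scalar_st p * Y)"
proof
  assume "\<exists>Y. X = scalar_st p * Y"
  then show "divides_st (complexify_st p) (complexify_quat_st X)"
    unfolding divides_st_def by (metis complexify_quat_st_mult complexify_quat_scalar_st)
next
  assume "divides_st (complexify_st p) (complexify_quat_st X)"
  then obtain Z where Z: "complexify_quat_st X = scalar_st (complexify_st p) * Z"
    unfolding divides_st_def by blast
  define Y where "Y = Poly_Mapping.map (map_quaternion Re) Z"
  have Y: "Poly_Mapping.lookup Y k = map_quaternion Re (Poly_Mapping.lookup Z k)" for k
    by (simp add: Y_def Poly_Mapping.map.rep_eq when_def quaternion_eq_iff)
  have "X = scalar_st p * Y"
  proof (rule poly_st_eqI)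
    fix m n
    have "Poly_Mapping.lookup X (m, n) =
        map_quaternion Re (Poly_Mapping.lookup (complexify_quat_st X) (m, n))"
      by (simp add: lookup_complexify_quat_st quaternion_eq_iff)
    also have "\<dots> = (\<Sum>i\<le>m. \<Sum>j\<le>n. map_quaternion Re
        (quat_scalar (complex_of_real (Poly_Mapping.lookup p (i, j))) *
          Poly_Mapping.lookup Z (m - i, n - j)))"
      by (simp add: Z lookup_mult_st lookup_scalar_st lookup_complexify_st map_quaternion_sum)
    \<comment> \<open>The scalar factor is real, and \<open>Re\<close> is real linear.\<close>
    also have "\<dots> = Poly_Mapping.lookup (scalar_st p * Y) (m, n)"
      unfolding lookup_mult_st lookup_scalar_st Y
      by (intro sum.cong refl) (simp add: quaternion_eq_iff)
    finally show "Poly_Mapping.lookup X (m, n) = Poly_Mapping.lookup (scalar_st p * Y) (m, n)" .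
  qed
  then show "\<exists>Y. X = scalar_st p * Y" ..
qed

section \<open>Division with remainder by a monic quadratic in \<open>t\<close>\<close>

lemma in_t_pCons: "in_t (pCons a p) = const_st a + var_t * in_t p"
  for p :: "'a::ring_1 poly"
  by (rule poly_st_eqI)
    (auto simp: lookup_add lookup_in_t lookup_var_t_mult const_st_def lookup_single when_def
      coeff_pCons split: nat.splits)

lemma in_t_zero [simp]: "in_t 0 = 0"
  by (rule poly_st_eqI) (simp add: lookup_in_t)

lemma scalar_in_t_quadratic:
  fixes P :: "real poly"
  assumes "degree P = 2" and "lead_coeff P = 1"
  shows "scalar_st (in_t P) = var_t * var_t + const_st (quat_scalar (coeff P 1)) * var_t +
    const_st (quat_scalar (coeff P 0))"
proof (rule poly_st_eqI)
  fix m n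
  have P: "coeff P 2 = 1" "\<And>k. k > 2 \<Longrightarrow> coeff P k = 0"
    using assms by (auto simp: coeff_eq_0)
  consider "n = 0" | "n = 1" | "n = 2" | "n > (2::nat)" by linarith
  then show "Poly_Mapping.lookup (scalar_st (in_t P)) (m, n) =
      Poly_Mapping.lookup (var_t * var_t + const_st (quat_scalar (coeff P 1)) * var_t +
        const_st (quat_scalar (coeff P 0))) (m, n)"
    by cases (auto simp: P lookup_scalar_st lookup_in_t lookup_add lookup_var_t_mult
        lookup_const_st_mult lookup_var_t lookup_const_st quaternion_eq_iff)
qed

text \<open>A degree argument in \<open>t\<close>, valid for any coefficient ring because the
  quadratic is monic: the top coefficient of a nonzero \<open>Y\<close> would reappear two powers
  higher, where the linear side has none.\<close>

lemma linear_multiple_of_quadratic: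
  fixes Y :: "'a::ring_1 poly_st"
  assumes eq: "(var_t * var_t + const_st p1 * var_t + const_st p0) * Y =
    const_st e1 * var_t + const_st e0"
  shows "e1 = 0" and "e0 = 0"
proof -
  have "Y = 0"
  proof (rule ccontr)
    assume "Y \<noteq> 0"
    then obtain k where "k \<in> Poly_Mapping.keys Y"
      using keys_eq_empty by blast
    \<comment> \<open>\<open>n\<close> is the largest exponent of \<open>t\<close> in
      \<open>Y\<close> over all powers of \<open>s\<close>; \<open>m\<close> is a power of
      \<open>s\<close> that occurs with it.\<close>
    define n where "n = Max (snd ` Poly_Mapping.keys Y)"
    have "n \<in> snd ` Poly_Mapping.keys Y"
      unfolding n_def using \<open>k \<in> _\<close> by (intro Max_in) auto
    then obtain m where m: "Poly_Mapping.lookup Y (m, n) \<noteq> 0"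
      by (auto simp: in_keys_iff)
    have above: "Poly_Mapping.lookup Y (m, l) = 0" if "l > n" for l
    proof (rule ccontr)
      assume "Poly_Mapping.lookup Y (m, l) \<noteq> 0"
      then have "snd (m, l) \<in> snd ` Poly_Mapping.keys Y"
        by (intro imageI) (simp add: in_keys_iff)
      then have "l \<le> n" unfolding n_def by (intro Max_ge) auto
      with that show False by simp
    qed
    \<comment> \<open>The terms with \<open>p1\<close> and \<open>p0\<close> contribute the
      coefficients of \<open>Y\<close> at \<open>n + 1\<close> and \<open>n + 2\<close>, which
      vanish.\<close>
    have "Poly_Mapping.lookup Y (m, n) = Poly_Mapping.lookup
        ((var_t * var_t + const_st p1 * var_t + const_st p0) * Y) (m, n + 2)"
      by (simp add: distrib_right mult.assoc lookup_add lookup_var_t_mult lookup_const_st_mult above)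
    also have "\<dots> = 0"
      unfolding eq by (simp add: lookup_add lookup_const_st_mult lookup_var_t lookup_const_st)
    finally show False using m by simp
  qed
  then have *: "const_st e1 * var_t + const_st e0 = 0" using eq by simp
  have "Poly_Mapping.lookup (const_st e1 * var_t + const_st e0) (0, k) =
      (if k = 0 then e0 else if k = 1 then e1 else 0)" for k
    by (simp add: lookup_add lookup_const_st_mult lookup_var_t lookup_const_st)
  from this [of 0] this [of 1] show "e1 = 0" "e0 = 0"
    unfolding * by simp_all
qed

text \<open>Induction along the Horner form of \<open>q\<close>; as the divisor is monic, no
  coefficient has to be inverted.\<close>

lemma in_t_division:
  fixes q :: "'a::ring_1 poly"
  shows "\<exists>S a b. in_t q = (var_t * var_t + const_st p1 * var_t + const_st p0) * S +
    const_st a * var_t + const_st b"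
proof (induction q)
  case 0
  have "in_t 0 = (var_t * var_t + const_st p1 * var_t + const_st p0) * 0 +
      const_st 0 * var_t + const_st (0 :: 'a)"
    by simp
  then show ?case by blast
next
  case (pCons c q)
  let ?p = "var_t * var_t + const_st p1 * var_t + const_st p0"
  obtain S a b where q: "in_t q = ?p * S + const_st a * var_t + const_st b"
    using pCons by blast
  have left_commute: "var_t * (const_st e * X) = const_st e * (var_t * X)"
    for e and X :: "'a poly_st"
    by (metis mult.assoc var_t_commute)
  \<comment> \<open>Multiplying the old remainder by \<open>t\<close> creates
    \<open>a * t^2\<close>, which is rewritten as
    \<open>?p * a - p1 * a * t - p0 * a\<close>.\<close>
  have "in_t (pCons c q) = ?p * (var_t * S + const_st a)
      + const_st (b - p1 * a) * var_t + const_st (c - p0 * a)"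
    unfolding in_t_pCons q const_st_arith const_st_mult
    by (simp add: algebra_simps var_t_commute [of "const_st _"] left_commute)
  then show ?case by blast
qed

section \<open>Norm, inverses and a common root over the real quaternions\<close>

lemma quat_mult_cnj:
  "x * quat_cnj x = quat_scalar ((Q1 x)\<^sup>2 + (Qi x)\<^sup>2 + (Qj x)\<^sup>2 + (Qk x)\<^sup>2)"
  for x :: "'a::comm_ring_1 quaternion"
  by (simp add: quaternion_eq_iff power2_eq_square algebra_simps)

lemma quat_cnj_mult_commute: "quat_cnj x * x = x * quat_cnj x"
  for x :: "'a::comm_ring_1 quaternion"
  by (simp add: quaternion_eq_iff algebra_simps)

text \<open>A sum of four real squares vanishes only if each square does; nonzero complex
  quaternions can have norm zero.\<close>

lemma real_quaternion_mult_cnj_eq_0: "x * quat_cnj x = 0 \<longleftrightarrow> x = 0"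
  for x :: "real quaternion"
  by (auto simp: quat_mult_cnj quaternion_eq_iff[of _ 0] add_nonneg_eq_0_iff)

text \<open>The inverse is the conjugate divided by the norm.\<close>

lemma real_quaternion_inverse:
  fixes x :: "real quaternion"
  assumes "x \<noteq> 0"
  obtains u where "u * x = 1" and "x * u = 1"
proof -
  define r where "r = (Q1 x)\<^sup>2 + (Qi x)\<^sup>2 + (Qj x)\<^sup>2 + (Qk x)\<^sup>2"
  have x: "x * quat_cnj x = quat_scalar r"
    by (simp add: quat_mult_cnj r_def)
  with assms have "r \<noteq> 0"
    using real_quaternion_mult_cnj_eq_0 [of x] by (auto simp: quaternion_eq_iff)
  then have r: "quat_scalar (1 / r) * quat_scalar r = 1"
    by (simp add: quaternion_eq_iff)
  show thesis
  proof
    show "quat_scalar (1 / r) * quat_cnj x * x = 1"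
      by (simp add: mult.assoc quat_cnj_mult_commute x r)
    show "x * (quat_scalar (1 / r) * quat_cnj x) = 1"
      by (metis mult.assoc quat_scalar_commute r x)
  qed
qed

text \<open>With \<open>R i = A i * t + B i\<close> and \<open>P = t^2 + p1 * t + p0\<close>, the
  hypotheses compare the lower coefficients in \<open>R i * cnj (R j) = A i * cnj (A j) * P\<close>.
  Trace and norm of \<open>h\<close> encode \<open>P = (t - h) * cnj (t - h)\<close>, and the last
  conclusion is \<open>R i = A i * (t - h)\<close>.\<close>

lemma common_right_root:
  fixes A B :: "'b \<Rightarrow> real quaternion"
  assumes linear: "\<And>i j. i \<in> I \<Longrightarrow> j \<in> I \<Longrightarrow>
      A i * quat_cnj (B j) + B i * quat_cnj (A j) = quat_scalar p1 * (A i * quat_cnj (A j))"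
    and const: "\<And>i j. i \<in> I \<Longrightarrow> j \<in> I \<Longrightarrow>
      B i * quat_cnj (B j) = quat_scalar p0 * (A i * quat_cnj (A j))"
    and "k \<in> I" and "A k \<noteq> 0"
  obtains h where "h + quat_cnj h = - quat_scalar p1" and "h * quat_cnj h = quat_scalar p0"
    and "\<And>i. i \<in> I \<Longrightarrow> B i = - (A i * h)"
proof -
  obtain u where u: "u * A k = 1"
    using real_quaternion_inverse [OF \<open>A k \<noteq> 0\<close>] by blast
  define v where "v = quat_cnj u"
  have v: "quat_cnj (A k) * v = 1"
    using arg_cong [OF u, of quat_cnj] by (simp add: quat_cnj_mult v_def)
  define h where "h = - (u * B k)"
  have cnj_h: "quat_cnj h = - (quat_cnj (B k) * v)"
    by (simp add: h_def quat_cnj_mult v_def)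
  \<comment> \<open>Cancelling \<open>quat_cnj (A k)\<close> on the right of the linear identity for
    \<open>j = k\<close> expresses \<open>B i\<close> through \<open>quat_cnj h\<close>; the trace
    of \<open>h\<close> turns this into the wanted form at the end.\<close>
  have B_cnj: "B i = A i * (quat_scalar p1 + quat_cnj h)" if "i \<in> I" for i
  proof -
    have "(A i * quat_cnj (B k) + B i * quat_cnj (A k)) * v =
        quat_scalar p1 * (A i * quat_cnj (A k)) * v"
      using linear [OF that \<open>k \<in> I\<close>] by simp
    then have "A i * (quat_cnj (B k) * v) + B i = quat_scalar p1 * A i"
      by (simp only: distrib_right mult.assoc v mult_1_right)
    then have "B i = quat_scalar p1 * A i - A i * (quat_cnj (B k) * v)"
      by (metis add_diff_cancel_left')
    then show ?thesis
      by (simp add: right_diff_distrib quat_scalar_commute cnj_h)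
  qed
  \<comment> \<open>The left side is \<open>- h\<close> by definition, so the case
    \<open>i = k\<close> yields the trace.\<close>
  have "u * B k = quat_scalar p1 + quat_cnj h"
    using B_cnj [OF \<open>k \<in> I\<close>] u by (metis mult.assoc mult_1_left)
  then have trace: "h + quat_cnj h = - quat_scalar p1"
    by (simp add: h_def algebra_simps)
  show thesis
  proof
    show "h + quat_cnj h = - quat_scalar p1" by (fact trace)
    \<comment> \<open>Multiplying the constant identity for \<open>i = j = k\<close> by
      \<open>u\<close> and \<open>v\<close> turns its left side into
      \<open>h * quat_cnj h\<close>.\<close>
    have "u * (B k * quat_cnj (B k)) * v = u * (quat_scalar p0 * (A k * quat_cnj (A k))) * v"
      using const [OF \<open>k \<in> I\<close> \<open>k \<in> I\<close>] by simp
    also have "\<dots> = quat_scalar p0 * ((u * A k) * (quat_cnj (A k) * v))"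
      by (metis mult.assoc quat_scalar_commute)
    also have "\<dots> = quat_scalar p0" by (simp add: u v)
    finally show "h * quat_cnj h = quat_scalar p0"
      unfolding cnj_h by (simp add: h_def mult.assoc)
    show "B i = - (A i * h)" if "i \<in> I" for i
    proof -
      have "quat_scalar p1 + quat_cnj h = - h"
        using trace by (simp add: eq_neg_iff_add_eq_0 ac_simps)
      then show ?thesis using B_cnj [OF that] by simp
    qed
  qed
qed

section \<open>The norm of \<open>t - h\<close>, which is the characteristic polynomial of
  \<open>h\<close>\<close>

lemma linear_norm:
  "(var_t - const_st h) * cnj_st (var_t - const_st h) =
    var_t * var_t + const_st (- (h + quat_cnj h)) * var_t + const_st (h * quat_cnj h)"
  for h :: "'a::comm_ring_1 quaternion"
  by (simp add: const_st_arith const_st_mult algebra_simps var_t_commute [of "const_st _"])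

text \<open>\<open>h\<close> and \<open>quat_cnj h\<close> have the same trace and norm, hence the
  same quadratic.\<close>

lemma linear_norm_commute:
  "cnj_st (var_t - const_st h) * (var_t - const_st h) =
    (var_t - const_st h) * cnj_st (var_t - const_st h)"
  for h :: "'a::comm_ring_1 quaternion"
  using linear_norm [of "quat_cnj h"] linear_norm [of h]
  by (simp add: quat_cnj_mult_commute add.commute)

section \<open>Right factors \<open>t - h\<close> of polynomials expanded in powers of
  \<open>s\<close>\<close>

lemma s_coefficient_exists:
  fixes X :: "'a::zero poly_st"
  shows "\<exists>Y :: 'a poly_st. \<forall>m n. Poly_Mapping.lookup Y (m, n) =
    (if m = 0 then Poly_Mapping.lookup X (i, n) else 0)"
proof -
  let ?f = "\<lambda>(m :: nat, n). if m = 0 then Poly_Mapping.lookup X (i, n) else 0"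
  \<comment> \<open>The support stays finite: it lies in the image of the support of
    \<open>X\<close> under setting the exponent of \<open>s\<close> to \<open>0\<close>.\<close>
  have "{k. ?f k \<noteq> 0} \<subseteq> (\<lambda>(m, n). (0, n)) ` Poly_Mapping.keys X"
    by (force simp: in_keys_iff split: if_splits)
  then have "finite {k. ?f k \<noteq> 0}"
    by (rule finite_subset) simp
  then have "Poly_Mapping.lookup (Abs_poly_mapping ?f) = ?f"
    by (rule lookup_Abs_poly_mapping)
  then show ?thesis by (metis (mono_tags, lifting) case_prod_conv)
qed

text \<open>Part (a) over the reals, with primitivity entering as non-divisibility by
  \<open>P\<close>. In this form it applies to \<open>cnj_st Q\<close> as well, which gives part
  (b).\<close>

lemma right_linear_factor_iff:
  fixes Q :: "real quaternion poly_st" and Qc :: "nat \<Rightarrow> real quaternion poly" and P :: "real poly"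
  assumes Q: "Q = (\<Sum>i\<le>d. in_t (Qc i) * var_s ^ i)"
    and "degree P = 2" and "lead_coeff P = 1"
    and ndvd: "\<nexists>Y. Q = scalar_st (in_t P) * Y"
  shows "(\<forall>i\<le>d. \<forall>j\<le>d. \<exists>Y. in_t (Qc i) * cnj_st (in_t (Qc j)) = scalar_st (in_t P) * Y) \<longleftrightarrow>
    (\<exists>Q' h. Q = Q' * (var_t - const_st h) \<and>
      scalar_st (in_t P) = (var_t - const_st h) * cnj_st (var_t - const_st h))"
    (is "?div \<longleftrightarrow> ?fact")
proof
  define p where "p = scalar_st (in_t P)"
  define p1 p0 where "p1 = coeff P 1" and "p0 = coeff P 0"
  have p: "p = var_t * var_t + const_st (quat_scalar p1) * var_t + const_st (quat_scalar p0)"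
    using scalar_in_t_quadratic [OF assms(2,3)] by (simp add: p_def p1_def p0_def)
  have p_commute: "p * X = X * p" for X
    by (simp add: p_def scalar_st_commute)
  have cnj_p: "cnj_st p = p" by (simp add: p_def)
  {
    \<comment> \<open>This direction is kept in a block so that the facts on \<open>p\<close> serve
      both directions.\<close>
    assume ?div
    then have dvd: "\<exists>Y. in_t (Qc i) * cnj_st (in_t (Qc j)) = p * Y" if "i \<le> d" "j \<le> d" for i j
      using that by (auto simp: p_def)
    have "\<forall>i. \<exists>S a b. in_t (Qc i) = p * S + const_st a * var_t + const_st b"
      unfolding p using in_t_division by blast
    then obtain S A B where
      Qc: "\<And>i. in_t (Qc i) = p * S i + const_st (A i) * var_t + const_st (B i)"
      by metis
    have rem: "A i * quat_cnj (B j) + B i * quat_cnj (A j) = quat_scalar p1 * (A i * quat_cnj (A j))"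
        "B i * quat_cnj (B j) = quat_scalar p0 * (A i * quat_cnj (A j))"
      if ij: "i \<le> d" "j \<le> d" for i j
    proof -
      obtain Y where Y: "in_t (Qc i) * cnj_st (in_t (Qc j)) = p * Y"
        using dvd [OF ij] by blast
      let ?R = "\<lambda>i. const_st (A i) * var_t + const_st (B i)"
      let ?R' = "const_st (quat_cnj (A j)) * var_t + const_st (quat_cnj (B j))"
      \<comment> \<open>\<open>?E1\<close> and \<open>?E0\<close> are the coefficients of the
        remainder of \<open>?R i * ?R'\<close> modulo \<open>p\<close>, the quotient being the
        constant \<open>A i * quat_cnj (A j)\<close>.\<close>
      let ?E1 = "A i * quat_cnj (B j) + B i * quat_cnj (A j) - quat_scalar p1 * (A i * quat_cnj (A j))"
      let ?E0 = "B i * quat_cnj (B j) - quat_scalar p0 * (A i * quat_cnj (A j))"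
      have cnj: "cnj_st (in_t (Qc j)) = p * cnj_st (S j) + ?R'"
        by (simp add: Qc cnj_st_mult cnj_p p_commute [of "cnj_st (S j)"]
            var_t_commute [of "const_st _"] add.assoc)
      have lc: "var_t * (const_st e * X) = const_st e * (var_t * X)"
        for e and X :: "real quaternion poly_st"
        by (metis mult.assoc var_t_commute)
      have low: "?R i * ?R' = p * const_st (A i * quat_cnj (A j)) + (const_st ?E1 * var_t + const_st ?E0)"
        unfolding p const_st_arith const_st_mult
        by (simp add: algebra_simps var_t_commute [of "const_st _"] lc)
      have "in_t (Qc i) * cnj_st (in_t (Qc j)) =
          p * (S i * cnj_st (in_t (Qc j))) + ?R i * (p * cnj_st (S j)) + ?R i * ?R'"
        by (subst (1) Qc) (simp add: cnj algebra_simps)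
      also have "?R i * (p * cnj_st (S j)) = p * (?R i * cnj_st (S j))"
        by (metis mult.assoc p_commute)
      finally have "p * Y = p * (S i * cnj_st (in_t (Qc j))) + p * (?R i * cnj_st (S j)) + ?R i * ?R'"
        unfolding Y .
      \<comment> \<open>All multiples of \<open>p\<close> are collected on the left; what remains is
        at most linear in \<open>t\<close>, so its coefficients vanish.\<close>
      then have "p * (Y - S i * cnj_st (in_t (Qc j)) - ?R i * cnj_st (S j)
          - const_st (A i * quat_cnj (A j))) = const_st ?E1 * var_t + const_st ?E0"
        unfolding low right_diff_distrib by simp
      from linear_multiple_of_quadratic [OF this [unfolded p]]
      show "A i * quat_cnj (B j) + B i * quat_cnj (A j) = quat_scalar p1 * (A i * quat_cnj (A j))"
        "B i * quat_cnj (B j) = quat_scalar p0 * (A i * quat_cnj (A j))"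
        by simp_all
    qed
    have "\<exists>k\<in>{..d}. A k \<noteq> 0"
    proof (rule ccontr)
      assume "\<not> (\<exists>k\<in>{..d}. A k \<noteq> 0)"
      then have A: "A k = 0" if "k \<le> d" for k using that by auto
      \<comment> \<open>For \<open>i = j = k\<close> the constant identity now says that
        \<open>B k\<close> has norm zero.\<close>
      have "B k = 0" if "k \<le> d" for k
        using rem(2) [OF that that] A [OF that] by (simp add: real_quaternion_mult_cnj_eq_0)
      then have "Q = p * (\<Sum>i\<le>d. S i * var_s ^ i)"
        unfolding Q sum_distrib_left by (intro sum.cong) (simp_all add: Qc A mult.assoc)
      then show False using ndvd unfolding p_def by blast
    qed
    then obtain k where k: "k \<in> {..d}" "A k \<noteq> 0" by blast
    obtain h where trace: "h + quat_cnj h = - quat_scalar p1" and norm: "h * quat_cnj h = quat_scalar p0"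
      and B: "\<And>i. i \<in> {..d} \<Longrightarrow> B i = - (A i * h)"
      using common_right_root [of "{..d}" A B p1 p0 k] rem k by (metis atMost_iff)
    let ?L = "var_t - const_st h"
    have p_norm: "p = ?L * cnj_st ?L"
      unfolding linear_norm trace norm by (simp add: p)
    have "in_t (Qc i) * var_s ^ i =
        (S i * cnj_st ?L + const_st (A i)) * var_s ^ i * ?L" if "i \<le> d" for i
    proof -
      \<comment> \<open>Centrality moves \<open>p\<close> behind \<open>S i\<close>, and its two
        linear factors commute, so \<open>?L\<close> can be put last.\<close>
      have "p * S i = S i * cnj_st ?L * ?L"
        by (metis p_commute p_norm mult.assoc linear_norm_commute)
      moreover have "const_st (A i) * var_t + const_st (B i) = const_st (A i) * ?L"
        using B [of i] that by (simp add: const_st_arith const_st_mult right_diff_distrib)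
      ultimately have "in_t (Qc i) = (S i * cnj_st ?L + const_st (A i)) * ?L"
        by (simp add: Qc distrib_right add.assoc)
      then show ?thesis
        by (simp only: mult.assoc var_s_power_commute)
    qed
    then have "Q = (\<Sum>i\<le>d. (S i * cnj_st ?L + const_st (A i)) * var_s ^ i) * ?L"
      unfolding Q sum_distrib_right by (intro sum.cong) simp_all
    then show ?fact using p_norm unfolding p_def by blast
  }
  assume ?fact
  then obtain Q' h where Q': "Q = Q' * (var_t - const_st h)"
    and norm: "p = (var_t - const_st h) * cnj_st (var_t - const_st h)"
    unfolding p_def by blast
  let ?L = "var_t - const_st h"
  \<comment> \<open>Since \<open>?L\<close> is free of \<open>s\<close>, multiplication by it acts
    on each coefficient of a power of \<open>s\<close> separately; \<open>C\<close> is the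
    coefficient of \<open>s ^ i\<close> in \<open>Q'\<close>.\<close>
  have "\<exists>C. in_t (Qc i) = C * ?L" if i: "i \<le> d" for i
  proof -
    obtain C where C: "\<And>(m :: nat) n. Poly_Mapping.lookup C (m, n) =
        (if m = 0 then Poly_Mapping.lookup Q' (i, n) else 0)"
      using s_coefficient_exists [of Q' i] by blast
    have "in_t (Qc i) = C * ?L"
    proof (rule poly_st_eqI)
      fix m n
      have "Poly_Mapping.lookup Q (i, n) = (\<Sum>k\<le>d. if k = i then coeff (Qc k) n else 0)"
        unfolding Q lookup_sum
        by (intro sum.cong) (auto simp: lookup_mult_var_s_power lookup_in_t)
      then have "coeff (Qc i) n = Poly_Mapping.lookup (Q' * ?L) (i, n)"
        using i by (simp add: Q')
      then show "Poly_Mapping.lookup (in_t (Qc i)) (m, n) = Poly_Mapping.lookup (C * ?L) (m, n)"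
        by (simp add: lookup_in_t C right_diff_distrib lookup_minus lookup_mult_var_t
            lookup_mult_const_st)
    qed
    then show ?thesis ..
  qed
  then obtain C where C: "\<And>i. i \<le> d \<Longrightarrow> in_t (Qc i) = C i * ?L" by metis
  have "in_t (Qc i) * cnj_st (in_t (Qc j)) = p * (C i * cnj_st (C j))" if "i \<le> d" "j \<le> d" for i j
  proof -
    \<comment> \<open>The two linear factors meet in the middle and form the central
      \<open>p\<close>.\<close>
    have "in_t (Qc i) * cnj_st (in_t (Qc j)) = C i * (?L * cnj_st ?L) * cnj_st (C j)"
      by (simp only: C that cnj_st_mult mult.assoc)
    also have "\<dots> = p * (C i * cnj_st (C j))"
      by (simp only: norm [symmetric] p_commute [of "C i", symmetric] mult.assoc)
    finally show ?thesis .
  qed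
  then show ?div unfolding p_def by blast
qed

section \<open>Both parts, by descent to real coefficients and by conjugation\<close>

theorem theoremI:
  fixes Q :: "real quaternion poly_st"
    and d :: nat
    and Qc :: "nat \<Rightarrow> real quaternion poly"
    and P :: "real poly"
  assumes "primitive_st (complexify_quat_st Q)"
    and "d > 0"
    and "Q = (\<Sum>i\<le>d. in_t (Qc i) * var_s ^ i)"
    and "degree P = 2" and "lead_coeff P = 1"
  shows "((\<forall>i\<in>{0..d}. \<forall>j\<in>{0..d}.
            divides_st (complexify_st (in_t P))
              (complexify_quat_st (in_t (Qc i) * cnj_st (in_t (Qc j))))) \<longleftrightarrow>
         (\<exists>Q' h. Q = Q' * (var_t - const_st h) \<and>
            scalar_st (in_t P) = (var_t - const_st h) * cnj_st (var_t - const_st h))) \<and>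
         ((\<forall>i\<in>{0..d}. \<forall>j\<in>{0..d}.
            divides_st (complexify_st (in_t P))
              (complexify_quat_st (cnj_st (in_t (Qc i)) * in_t (Qc j)))) \<longleftrightarrow>
         (\<exists>Q' h. Q = (var_t - const_st h) * Q' \<and>
            scalar_st (in_t P) = (var_t - const_st h) * cnj_st (var_t - const_st h)))"
proof -
  let ?p = "scalar_st (in_t P) :: real quaternion poly_st"
  \<comment> \<open>The coefficient of \<open>t^2\<close> is \<open>1\<close>, so primitivity
    applies to this polynomial.\<close>
  have "complexify_st (in_t P) \<noteq> const_st c" for c
  proof
    assume "complexify_st (in_t P) = const_st c"
    then have "Poly_Mapping.lookup (complexify_st (in_t P)) (0, 2) = Poly_Mapping.lookup (const_st c) (0, 2)"
      by simp
    then show False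
      using assms(4,5) by (simp add: lookup_complexify_st lookup_in_t const_st_def lookup_single)
  qed
  then have ndvd: "\<nexists>Y. Q = ?p * Y"
    using assms(1) unfolding primitive_st_def divides_st_complexify_iff [symmetric] by blast
  \<comment> \<open>\<open>?p\<close> is central and equal to its conjugate, so it divides
    \<open>cnj_st Q\<close> only if it divides \<open>Q\<close>.\<close>
  have ndvd_cnj: "\<nexists>Y. cnj_st Q = ?p * Y"
  proof
    assume "\<exists>Y. cnj_st Q = ?p * Y"
    then obtain Y where "cnj_st Q = ?p * Y" ..
    then have "cnj_st (cnj_st Q) = cnj_st (?p * Y)" by (rule arg_cong)
    then have "Q = ?p * cnj_st Y"
      by (simp add: cnj_st_mult scalar_st_commute [of _ "cnj_st Y"])
    then show False using ndvd by blast
  qed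
  have "cnj_st Q = (\<Sum>i\<le>d. in_t (map_poly quat_cnj (Qc i)) * var_s ^ i)"
    by (simp add: assms(3) cnj_st_sum cnj_st_mult cnj_st_in_t var_s_power_commute)
  \<comment> \<open>Here the products of part (a) become those of part (b), since conjugating
    \<open>Qc j\<close> twice restores it.\<close>
  note cnj = right_linear_factor_iff [OF this assms(4,5) ndvd_cnj]
  \<comment> \<open>Conjugation turns a right factor \<open>t - h\<close> into a left factor with
    root \<open>quat_cnj h\<close>, which has the same norm polynomial.\<close>
  have "(\<exists>Q' h. cnj_st Q = Q' * (var_t - const_st h) \<and>
        ?p = (var_t - const_st h) * cnj_st (var_t - const_st h)) \<longleftrightarrow>
      (\<exists>Q' h. Q = (var_t - const_st h) * Q' \<and>
        ?p = (var_t - const_st h) * cnj_st (var_t - const_st h))" (is "?l \<longleftrightarrow> ?r")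
  proof
    assume ?l
    then obtain Q' h where Q': "cnj_st Q = Q' * (var_t - const_st h)"
      and "?p = (var_t - const_st h) * cnj_st (var_t - const_st h)" by blast
    moreover have "Q = cnj_st (Q' * (var_t - const_st h))"
      by (simp flip: Q')
    ultimately have "Q = (var_t - const_st (quat_cnj h)) * cnj_st Q'"
      and "?p = (var_t - const_st (quat_cnj h)) * cnj_st (var_t - const_st (quat_cnj h))"
      using linear_norm_commute [of h] by (simp_all add: cnj_st_mult)
    then show ?r by blast
  next
    assume ?r
    then obtain Q' h where "Q = (var_t - const_st h) * Q'"
      and "?p = (var_t - const_st h) * cnj_st (var_t - const_st h)" by blast
    then have "cnj_st Q = cnj_st Q' * (var_t - const_st (quat_cnj h))"
      and "?p = (var_t - const_st (quat_cnj h)) * cnj_st (var_t - const_st (quat_cnj h))"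
      using linear_norm_commute [of h] by (simp_all add: cnj_st_mult)
    then show ?l by blast
  qed
  then show ?thesis
    using right_linear_factor_iff [OF assms(3-5) ndvd] cnj
    by (simp add: divides_st_complexify_iff Ball_def flip: cnj_st_in_t)
qed

end
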